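(* Let $u$ be a local weak solution in $\Omega_T=\Omega\times(-T,T)$ to $$\partial_t u=\sum_{i=1}^N\partial_i\big(|\partial_i u|^{p_i-2}\partial_i u\big).$$ For $M,\rho>0$ such that $\mathcal{Q}_\rho(M)\subset\Omega_T$, define $$\tilde T_{\rho,M}(x,t)=\Big(\big(M^{\frac{p_i-2}{p_i}}\rho^{\frac{\bar p}{p_i}}x_i\big)_{i=1,\dots,N},\ \rho^{\bar p}t\Big).$$ Then the transformed function $$\mathcal{T}(u)(x,t)=M^{-1}u\big(\tilde T_{\rho,M}(x,t)\big)$$ is a local weak solution to the same equation in $\tilde T_{\rho,M}^{-1}(\Omega_T)$.
   Context: $N\in\mathbb{N}$, $N>1$; $\Omega\subset\mathbb{R}^N$ is a bounded open set, $T>0$. The exponents $p_1,\dots,p_N$ are fixed, $\bar p=N\big(\sum_{i=1}^N 1/p_i\big)^{-1}$, $\bar p<N$, $\bar p^*=N\bar p/(N-\bar p)$, and $2<p_1\le p_2\le\dots\le p_N<\bar p^*$. Full intrinsic cylinder: $\mathcal{Q}_\rho(M)=\prod_{i=1}^N\{|x_i|<M^{\frac{p_i-2}{p_i}}\rho^{\frac{\bar p}{p_i}}\}\times(-\rho^{\bar p},\rho^{\bar p}]$. Local weak solution: let $O\subset\mathbb{R}^N$ be open and $I\subset\mathbb{R}$ an open interval. A function $u\in C^0(I;L^2_{loc}(O))$ with $u\in L^1_{loc}(I;W^{1,1}_{loc}(O))$ and $\partial_i u\in L^{p_i}_{loc}(I;L^{p_i}_{loc}(O))$ for all $i$ is a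 local weak solution in $O\times I$ if for all $t_1<t_2$ in $I$, all compact $K\subset O$ and all smooth $\varphi$ on $O\times I$ with $\varphi(\cdot,t)$ supported in $K$ for every $t$, $$\int_K u\varphi\,dx\Big|_{t_1}^{t_2}+\int_{t_1}^{t_2}\!\!\int_K\Big(-u\,\partial_t\varphi+\sum_{i=1}^N|\partial_i u|^{p_i-2}\partial_i u\,\partial_i\varphi\Big)dx\,dt=0.$$ *)

theory Defs
  imports "HOL-Analysis.Analysis"
begin

text \<open>Class C^k on an open set: in finite dimension it suffices that all iterated
  directional derivatives up to order k exist and are continuous.\<close>

primrec Ck_on :: "nat \<Rightarrow> 'a::euclidean_space set \<Rightarrow> ('a \<Rightarrow> real) \<Rightarrow> bool" where
  "Ck_on 0 S f \<longleftrightarrow> continuous_on S f"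
| "Ck_on (Suc k) S f \<longleftrightarrow>
     (\<forall>x\<in>S. f differentiable (at x)) \<and>
     (\<forall>v. Ck_on k S (\<lambda>x. frechet_derivative f (at x) v))"

definition smooth_on :: "'a::euclidean_space set \<Rightarrow> ('a \<Rightarrow> real) \<Rightarrow> bool" where
  "smooth_on S f \<longleftrightarrow> (\<forall>k. Ck_on k S f)"

definition test_functions :: "'a::euclidean_space set \<Rightarrow> ('a \<Rightarrow> real) set" where
  "test_functions S = {\<phi>. smooth_on S \<phi> \<and> (\<exists>K. compact K \<and> K \<subseteq> S \<and> (\<forall>x\<in>S - K. \<phi> x = 0))}"

definition partial_x :: "'n::finite \<Rightarrow> ((real^'n) \<times> real \<Rightarrow> real) \<Rightarrow> (real^'n) \<times> real \<Rightarrow> real" where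
  "partial_x i \<phi> z = frechet_derivative \<phi> (at z) (axis i 1, 0)"

definition partial_t :: "((real^'n::finite) \<times> real \<Rightarrow> real) \<Rightarrow> (real^'n) \<times> real \<Rightarrow> real" where
  "partial_t \<phi> z = frechet_derivative \<phi> (at z) (0, 1)"

definition Lq_loc :: "real \<Rightarrow> (real^'n::finite) set \<Rightarrow> (real^'n \<Rightarrow> real) \<Rightarrow> bool" where
  "Lq_loc q S f \<longleftrightarrow>
     f \<in> borel_measurable (lebesgue_on S) \<and>
     (\<forall>K. compact K \<and> K \<subseteq> S \<longrightarrow> set_integrable lebesgue K (\<lambda>x. \<bar>f x\<bar> powr q))"

definition weak_partial ::
    "(real^'n::finite) set \<Rightarrow> 'n \<Rightarrow> (real^'n \<Rightarrow> real) \<Rightarrow> (real^'n \<Rightarrow> real) \<Rightarrow> bool" where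
  "weak_partial S i f g \<longleftrightarrow>
     Lq_loc 1 S f \<and> Lq_loc 1 S g \<and>
     (\<forall>\<phi>\<in>test_functions S.
        (LINT x:S|lebesgue. f x * frechet_derivative \<phi> (at x) (axis i 1)) =
        - (LINT x:S|lebesgue. g x * \<phi> x))"

text \<open>The Bochner space L^q_loc(I; L^q_loc(S)), whose elements are represented by jointly
  measurable functions on S x I.\<close>

definition Lq_loc_Lq_loc ::
    "real \<Rightarrow> real set \<Rightarrow> (real^'n::finite) set \<Rightarrow> ((real^'n) \<times> real \<Rightarrow> real) \<Rightarrow> bool" where
  "Lq_loc_Lq_loc q I S f \<longleftrightarrow>
     f \<in> borel_measurable (lebesgue_on (S \<times> I)) \<and>
     (AE t\<in>I in lebesgue. Lq_loc q S (\<lambda>x. f (x, t))) \<and>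
     (\<forall>J K. compact J \<and> J \<subseteq> I \<and> compact K \<and> K \<subseteq> S \<longrightarrow>
        set_integrable lebesgue J (\<lambda>t. LINT x:K|lebesgue. \<bar>f (x, t)\<bar> powr q))"

text \<open>u belongs to L^1_loc(I; W^{1,1}_loc(S)), with spatial weak gradient Du
  (which is determined almost everywhere by u).\<close>

definition L1_loc_W11_loc ::
    "real set \<Rightarrow> (real^'n::finite) set \<Rightarrow> ((real^'n) \<times> real \<Rightarrow> real) \<Rightarrow>
     ('n \<Rightarrow> (real^'n) \<times> real \<Rightarrow> real) \<Rightarrow> bool" where
  "L1_loc_W11_loc I S u Du \<longleftrightarrow>
     Lq_loc_Lq_loc 1 I S u \<and>
     (\<forall>i. Lq_loc_Lq_loc 1 I S (Du i)) \<and>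
     (AE t\<in>I in lebesgue. \<forall>i. weak_partial S i (\<lambda>x. u (x, t)) (\<lambda>x. Du i (x, t)))"

definition C0_L2_loc ::
    "real set \<Rightarrow> (real^'n::finite) set \<Rightarrow> ((real^'n) \<times> real \<Rightarrow> real) \<Rightarrow> bool" where
  "C0_L2_loc I S u \<longleftrightarrow>
     (\<forall>t\<in>I. Lq_loc 2 S (\<lambda>x. u (x, t))) \<and>
     (\<forall>K. compact K \<and> K \<subseteq> S \<longrightarrow>
        (\<forall>s\<in>I. ((\<lambda>t. LINT x:K|lebesgue. (u (x, t) - u (x, s))\<^sup>2) \<longlongrightarrow> 0) (at s within I)))"

text \<open>Only the values of u on the cylinder S x I matter.\<close>

definition local_weak_solution ::
    "('n::finite \<Rightarrow> real) \<Rightarrow> (real^'n) set \<Rightarrow> real set \<Rightarrow> ((real^'n) \<times> real \<Rightarrow> real) \<Rightarrow> bool" where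
  "local_weak_solution p S I u \<longleftrightarrow>
     C0_L2_loc I S u \<and>
     (\<exists>Du. L1_loc_W11_loc I S u Du \<and>
        (\<forall>i. Lq_loc_Lq_loc (p i) I S (Du i)) \<and>
        (\<forall>t1 t2 K \<phi>.
           t1 \<in> I \<and> t2 \<in> I \<and> t1 < t2 \<and> compact K \<and> K \<subseteq> S \<and>
           smooth_on (S \<times> I) \<phi> \<and> (\<forall>t\<in>I. \<forall>x\<in>S - K. \<phi> (x, t) = 0) \<longrightarrow>
           (LINT x:K|lebesgue. u (x, t2) * \<phi> (x, t2)) -
           (LINT x:K|lebesgue. u (x, t1) * \<phi> (x, t1)) +
           (LINT t:{t1..t2}|lebesgue. LINT x:K|lebesgue.
              - (u (x, t) * partial_t \<phi> (x, t)) +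
              (\<Sum>i\<in>UNIV. \<bar>Du i (x, t)\<bar> powr (p i - 2) * Du i (x, t) * partial_x i \<phi> (x, t))) = 0))"

text \<open>A local weak solution in a subset of space-time, which is required to be the product of
  an open set and an open interval.\<close>

definition local_weak_solution_in ::
    "('n::finite \<Rightarrow> real) \<Rightarrow> ((real^'n) \<times> real) set \<Rightarrow> ((real^'n) \<times> real \<Rightarrow> real) \<Rightarrow> bool" where
  "local_weak_solution_in p D u \<longleftrightarrow>
     (\<exists>S I. open S \<and> open I \<and> is_interval I \<and> D = S \<times> I \<and> local_weak_solution p S I u)"

definition pbar :: "('n::finite \<Rightarrow> real) \<Rightarrow> real" where
  "pbar p = real CARD('n) * inverse (\<Sum>i\<in>UNIV. 1 / p i)"

definition pbar_star :: "('n::finite \<Rightarrow> real) \<Rightarrow> real" where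
  "pbar_star p = real CARD('n) * pbar p / (real CARD('n) - pbar p)"

definition full_cylinder ::
    "('n::finite \<Rightarrow> real) \<Rightarrow> real \<Rightarrow> real \<Rightarrow> ((real^'n) \<times> real) set" where
  "full_cylinder p \<rho> M =
     {x. \<forall>i. \<bar>x $ i\<bar> < M powr ((p i - 2) / p i) * \<rho> powr (pbar p / p i)} \<times>
     {- (\<rho> powr pbar p) <.. \<rho> powr pbar p}"

definition T_tilde ::
    "('n::finite \<Rightarrow> real) \<Rightarrow> real \<Rightarrow> real \<Rightarrow> (real^'n) \<times> real \<Rightarrow> (real^'n) \<times> real" where
  "T_tilde p \<rho> M = (\<lambda>(x, t).
     (\<chi> i. M powr ((p i - 2) / p i) * \<rho> powr (pbar p / p i) * x $ i, \<rho> powr pbar p * t))"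

definition transform ::
    "('n::finite \<Rightarrow> real) \<Rightarrow> real \<Rightarrow> real \<Rightarrow> ((real^'n) \<times> real \<Rightarrow> real) \<Rightarrow> (real^'n) \<times> real \<Rightarrow> real" where
  "transform p \<rho> M u = (\<lambda>z. inverse M * u (T_tilde p \<rho> M z))"

end

theory Submission
  imports Defs
begin

text \<open>
  The map \<open>T_tilde\<close> is a diagonal linear map with positive entries: \<open>a i\<close> on the
  \<open>i\<close>-th spatial axis and \<open>\<tau>\<close> on the time axis. Let \<open>v = k u \<circ> T_tilde\<close> with \<open>k = 1 / M\<close>.
  Formally, the time derivative of \<open>v\<close> is \<open>k \<tau>\<close> times that of \<open>u\<close>, and the \<open>i\<close>-th
  diffusion term of \<open>v\<close> is \<open>k powr (p i - 1) * a i powr p i\<close> times that of \<open>u\<close>. The equation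
  is therefore preserved as soon as \<open>a i powr p i = k powr (2 - p i) * \<tau>\<close> for every \<open>i\<close>, and
  the intrinsic scaling \<open>a i = M powr ((p i - 2) / p i) * \<rho> powr (pbar p / p i)\<close>,
  \<open>\<tau> = \<rho> powr pbar p\<close> is chosen to have this property.

  For weak solutions, the chain rule moves from \<open>u\<close> to the test function. A dilation \<open>L\<close> is a
  linear bijection that transports every ingredient of the definition: compact subsets of
  \<open>L -` S\<close> are the preimages of compact subsets of \<open>S\<close>
  (\<open>compact_subset_vimage_dilation\<close>), the smooth functions on \<open>L -` S\<close> are the
  \<open>\<psi> \<circ> L\<close> with \<open>\<psi>\<close> smooth on \<open>S\<close> (\<open>smooth_on_vimage_dilation\<close>), and integrals change by the
  constant factor \<open>dilation_det L\<close> (\<open>set_integral_dilation\<close>). So the weak identity for \<open>v\<close>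
  tested with \<open>\<psi> \<circ> T_tilde\<close> is the weak identity for \<open>u\<close> tested with \<open>\<psi>\<close>, multiplied by
  one common constant. This is \<open>local_weak_solution_dilation\<close>; the pointwise computation with
  the powers is \<open>flux_scaling\<close>.
\<close>

section \<open>Dilations along the coordinate axes\<close>

text \<open>
  Diagonality is expressed through the standard basis, so that one notion covers the spatial
  map, the time scaling and the space-time map.
\<close>

definition axis_dilation :: "('a::euclidean_space \<Rightarrow> 'a) \<Rightarrow> bool" where
  "axis_dilation L \<longleftrightarrow> linear L \<and> (\<forall>b\<in>Basis. \<exists>c>0. L b = c *\<^sub>R b)"

definition dilation_det :: "('a::euclidean_space \<Rightarrow> 'a) \<Rightarrow> real" where
  "dilation_det L = (\<Prod>b\<in>Basis. L b \<bullet> b)"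

lemma axis_dilation_linear: "axis_dilation L \<Longrightarrow> linear L"
  by (simp add: axis_dilation_def)

lemma axis_dilation_Basis:
  assumes "axis_dilation L" "b \<in> Basis"
  shows "L b \<bullet> b > 0" "L b = (L b \<bullet> b) *\<^sub>R b"
proof -
  obtain c where "c > 0" "L b = c *\<^sub>R b"
    using assms by (auto simp: axis_dilation_def)
  with assms(2) show "L b \<bullet> b > 0" "L b = (L b \<bullet> b) *\<^sub>R b"
    by simp_all
qed

lemma axis_dilation_expansion:
  fixes L :: "'a::euclidean_space \<Rightarrow> 'a"
  assumes "axis_dilation L"
  shows "L x = (\<Sum>b\<in>Basis. ((L b \<bullet> b) * (x \<bullet> b)) *\<^sub>R b)"
proof -
  have "L x = L (\<Sum>b\<in>Basis. (x \<bullet> b) *\<^sub>R b)"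
    by (simp add: euclidean_representation)
  also have "\<dots> = (\<Sum>b\<in>Basis. (x \<bullet> b) *\<^sub>R L b)"
    using axis_dilation_linear[OF assms] by (simp add: linear_sum linear_scale)
  also have "\<dots> = (\<Sum>b\<in>Basis. ((L b \<bullet> b) * (x \<bullet> b)) *\<^sub>R b)"
  proof (rule sum.cong[OF refl])
    fix b :: 'a assume "b \<in> Basis"
    then have "(x \<bullet> b) *\<^sub>R L b = (x \<bullet> b) *\<^sub>R ((L b \<bullet> b) *\<^sub>R b)"
      using axis_dilation_Basis(2)[OF assms] by metis
    then show "(x \<bullet> b) *\<^sub>R L b = ((L b \<bullet> b) * (x \<bullet> b)) *\<^sub>R b"
      by (simp add: mult.commute)
  qed
  finally show ?thesis .
qed

lemma axis_dilation_inverse: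
  fixes L :: "'a::euclidean_space \<Rightarrow> 'a"
  assumes L: "axis_dilation L"
  obtains L' where "axis_dilation L'" "\<And>x. L (L' x) = x" "\<And>x. L' (L x) = x"
proof -
  define c where "c b = L b \<bullet> b" for b
  define L' where "L' x = (\<Sum>b\<in>Basis. (inverse (c b) * (x \<bullet> b)) *\<^sub>R b)" for x
  have lin: "linear L'"
    unfolding L'_def
    by (intro linear_compose_sum ballI linearI)
       (simp_all add: inner_add_left algebra_simps)
  have coord': "L' x \<bullet> b = inverse (c b) * (x \<bullet> b)" if "b \<in> Basis" for x b
    using that by (simp add: L'_def)
  have coord: "L x \<bullet> b = c b * (x \<bullet> b)" if "b \<in> Basis" for x b
    using that by (subst axis_dilation_expansion[OF L]) (simp add: c_def)
  have pos: "c b > 0" if "b \<in> Basis" for b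
    using axis_dilation_Basis(1)[OF L that] by (simp add: c_def)
  show thesis
  proof
    show "L (L' x) = x" for x
      by (rule euclidean_eqI) (use pos in \<open>force simp: coord coord'\<close>)
    show "L' (L x) = x" for x
      by (rule euclidean_eqI) (use pos in \<open>force simp: coord coord'\<close>)
    show "axis_dilation L'"
      unfolding axis_dilation_def
    proof (intro conjI ballI lin)
      fix b :: 'a assume b: "b \<in> Basis"
      have "L' b = inverse (c b) *\<^sub>R b"
        by (rule euclidean_eqI) (use b in \<open>auto simp: coord' inner_Basis\<close>)
      then show "\<exists>c>0. L' b = c *\<^sub>R b"
        using pos[OF b] by (intro exI[of _ "inverse (c b)"]) simp
    qed
  qed
qed

lemma dilation_det_pos: "axis_dilation L \<Longrightarrow> dilation_det L > 0"
  by (auto simp: dilation_det_def intro!: prod_pos axis_dilation_Basis)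

lemma axis_dilation_real: "\<tau> > 0 \<Longrightarrow> axis_dilation ((*) \<tau> :: real \<Rightarrow> real)"
  by (auto simp: axis_dilation_def linear_iff algebra_simps)

lemma axis_dilation_map_prod:
  assumes "axis_dilation A" "axis_dilation B"
  shows "axis_dilation (map_prod A B)"
proof -
  have "linear A" "linear B"
    using assms by (simp_all add: axis_dilation_linear)
  then have "linear (map_prod A B)" "A 0 = 0" "B 0 = 0"
    by (auto simp: linear_iff linear_0)
  then show ?thesis
    using assms by (auto simp: axis_dilation_def Basis_prod_def)
qed

lemma axis_dilation_vec:
  fixes a :: "'n::finite \<Rightarrow> real"
  assumes "\<And>i. a i > 0"
  shows "axis_dilation (\<lambda>x::real^'n. \<chi> i. a i * x $ i)"
proof -
  have "(\<chi> i. a i * (axis j 1 :: real^'n) $ i) = a j *\<^sub>R axis j 1" for j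
    by (simp add: vec_eq_iff axis_def)
  then show ?thesis
    using assms by (auto simp: axis_dilation_def linear_iff vec_eq_iff Basis_vec_def algebra_simps)
qed

text \<open>
  The definitions below quantify over compact subsets of the domain. This lemma brings such a
  set into the form of a preimage, to which the change of variables applies.
\<close>

lemma compact_subset_vimage_dilation:
  assumes L: "axis_dilation L" and K: "compact K" "K \<subseteq> L -` S"
  obtains K' where "compact K'" "K' \<subseteq> S" "K = L -` K'"
proof -
  obtain L' where L': "\<And>x. L' (L x) = x"
    using axis_dilation_inverse[OF L] by metis
  show thesis
  proof
    show "compact (L ` K)"
      using K axis_dilation_linear[OF L]
      by (intro compact_continuous_image) (simp_all add: linear_continuous_on linear_conv_bounded_linear)
    show "L ` K \<subseteq> S"
      using K by auto
    show "K = L -` L ` K"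
      using L' by (auto, metis)
  qed
qed

section \<open>Change of variables under a dilation\<close>

lemma
  fixes L :: "'a::euclidean_space \<Rightarrow> 'a"
  assumes L: "axis_dilation L"
  shows lebesgue_dilation: "lebesgue = density (distr lebesgue lebesgue L) (\<lambda>_. ennreal (dilation_det L))"
    and measurable_dilation: "L \<in> lebesgue \<rightarrow>\<^sub>M lebesgue"
proof -
  have nz: "L b \<bullet> b \<noteq> 0" and abs: "\<bar>L b \<bullet> b\<bar> = L b \<bullet> b" if "b \<in> Basis" for b
    using axis_dilation_Basis(1)[OF L that] by simp_all
  have expand: "L = (\<lambda>x. 0 + (\<Sum>b\<in>Basis. ((L b \<bullet> b) * (x \<bullet> b)) *\<^sub>R b))"
    unfolding add_0_left by (rule ext) (rule axis_dilation_expansion[OF L])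
  have det: "(\<Prod>b\<in>Basis. \<bar>L b \<bullet> b\<bar>) = dilation_det L"
    by (simp add: dilation_det_def abs)
  show "lebesgue = density (distr lebesgue lebesgue L) (\<lambda>_. ennreal (dilation_det L))"
    using lebesgue_affine_euclidean[of "\<lambda>b. L b \<bullet> b" 0, OF nz]
    unfolding expand[symmetric] det .
  show "L \<in> lebesgue \<rightarrow>\<^sub>M lebesgue"
    using lebesgue_affine_measurable[of "\<lambda>b. L b \<bullet> b" 0, OF nz]
    unfolding expand[symmetric] .
qed

lemma measurable_on_dilation:
  fixes L :: "'a::euclidean_space \<Rightarrow> 'a" and f :: "'a \<Rightarrow> real"
  assumes L: "axis_dilation L" and f: "f \<in> borel_measurable (lebesgue_on S)"
  shows "(\<lambda>x. f (L x)) \<in> borel_measurable (lebesgue_on (L -` S))"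
proof -
  have "L \<in> lebesgue_on (L -` S) \<rightarrow>\<^sub>M lebesgue_on S"
    by (intro measurable_restrict_space2 measurable_restrict_space1 measurable_dilation L)
       (auto simp: space_restrict_space)
  from measurable_comp[OF this f] show ?thesis
    by (simp add: comp_def)
qed

lemma AE_dilation:
  fixes L :: "'a::euclidean_space \<Rightarrow> 'a"
  assumes L: "axis_dilation L" and P: "AE x in lebesgue. P x"
  shows "AE x in lebesgue. P (L x)"
proof -
  have "AE x in density (distr lebesgue lebesgue L) (\<lambda>_. ennreal (dilation_det L)). P x"
    using P by (subst (asm) lebesgue_dilation[OF L])
  then have "AE x in distr lebesgue lebesgue L. P x"
    using dilation_det_pos[OF L] by (simp add: AE_density)
  then show ?thesis
    by (rule AE_distrD[OF measurable_dilation[OF L]])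
qed

lemma integrable_dilation:
  fixes L :: "'a::euclidean_space \<Rightarrow> 'a" and f :: "'a \<Rightarrow> real"
  assumes L: "axis_dilation L" and f: "integrable lebesgue f"
  shows "integrable lebesgue (\<lambda>x. f (L x))"
proof -
  have meas: "f \<in> borel_measurable (distr lebesgue lebesgue L)"
    using borel_measurable_integrable[OF f] by simp
  have "integrable (density (distr lebesgue lebesgue L) (\<lambda>_. ennreal (dilation_det L))) f"
    using f by (subst (asm) lebesgue_dilation[OF L])
  then have "integrable (distr lebesgue lebesgue L) (\<lambda>x. dilation_det L *\<^sub>R f x)"
    using dilation_det_pos[OF L] meas by (subst (asm) integrable_density) auto
  then have "integrable (distr lebesgue lebesgue L) f"
    using dilation_det_pos[OF L] by simp
  then show ?thesis
    using integrable_distr[OF measurable_dilation[OF L]] by blast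
qed

text \<open>
  Because the inverse of a dilation is again a dilation, \<open>f\<close> is integrable if and only if
  \<open>f \<circ> L\<close> is, and both integrals take the default value \<open>0\<close> otherwise. So the identity can
  be applied directly to the products in the weak formulations.
\<close>

lemma integral_dilation:
  fixes L :: "'a::euclidean_space \<Rightarrow> 'a" and f :: "'a \<Rightarrow> real"
  assumes L: "axis_dilation L"
  shows "(LINT x|lebesgue. f x) = dilation_det L * (LINT x|lebesgue. f (L x))"
proof (cases "integrable lebesgue f")
  case True
  then have meas: "f \<in> borel_measurable lebesgue"
    by (rule borel_measurable_integrable)
  have "(LINT x|lebesgue. f x) =
      (LINT x|density (distr lebesgue lebesgue L) (\<lambda>_. ennreal (dilation_det L)). f x)"
    by (subst lebesgue_dilation[OF L]) (rule refl)
  also have "\<dots> = (LINT x|distr lebesgue lebesgue L. dilation_det L *\<^sub>R f x)"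
    using dilation_det_pos[OF L] meas by (intro integral_density) auto
  also have "\<dots> = dilation_det L * (LINT x|distr lebesgue lebesgue L. f x)"
    by simp
  also have "(LINT x|distr lebesgue lebesgue L. f x) = (LINT x|lebesgue. f (L x))"
    by (rule integral_distr[OF measurable_dilation[OF L] meas])
  finally show ?thesis .
next
  case False
  obtain L' where L': "axis_dilation L'" "\<And>x. L (L' x) = x"
    using axis_dilation_inverse[OF L] by metis
  have "\<not> integrable lebesgue (\<lambda>x. f (L x))"
    using integrable_dilation[OF L'(1), of "\<lambda>x. f (L x)"] False L'(2) by auto
  with False show ?thesis
    by (simp add: not_integrable_integral_eq)
qed

lemma set_integral_cong_all:
  fixes f g :: "'a \<Rightarrow> real"
  assumes "\<And>x. x \<in> K \<Longrightarrow> f x = g x"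
  shows "(LINT x:K|M. f x) = (LINT x:K|M. g x)"
  unfolding set_lebesgue_integral_def
  by (rule Bochner_Integration.integral_cong) (auto simp: indicator_def assms)

lemma set_integrable_dilation:
  fixes L :: "'a::euclidean_space \<Rightarrow> 'a" and f :: "'a \<Rightarrow> real"
  assumes L: "axis_dilation L" and f: "set_integrable lebesgue K f"
  shows "set_integrable lebesgue (L -` K) (\<lambda>x. f (L x))"
  using integrable_dilation[OF L f[unfolded set_integrable_def]]
  by (simp add: set_integrable_def indicator_vimage comp_def)

lemma set_integral_dilation:
  fixes L :: "'a::euclidean_space \<Rightarrow> 'a" and f :: "'a \<Rightarrow> real"
  assumes L: "axis_dilation L"
  shows "(LINT x:L -` K|lebesgue. f (L x)) = (LINT x:K|lebesgue. f x) / dilation_det L"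
  using integral_dilation[OF L, of "\<lambda>x. indicator K x *\<^sub>R f x"] dilation_det_pos[OF L]
  by (simp add: set_lebesgue_integral_def indicator_vimage comp_def)

section \<open>Smooth functions and linear substitutions\<close>

text \<open>
  Openness of \<open>S\<close> matters: the derivatives in \<open>Ck_on\<close> are taken in the full space, hence
  they depend on the values of the function in a neighbourhood of the point.
\<close>

lemma Ck_on_cong:
  assumes "open S" "\<And>x. x \<in> S \<Longrightarrow> f x = g x" "Ck_on k S f"
  shows "Ck_on k S g"
  using assms(2,3)
proof (induction k arbitrary: f g)
  case 0
  then show ?case
    using continuous_on_cong by force
next
  case (Suc k)
  have D: "(g has_derivative frechet_derivative f (at x)) (at x)" if "x \<in> S" for x
  proof (rule has_derivative_transform_within_open[OF _ \<open>open S\<close> that])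
    show "(f has_derivative frechet_derivative f (at x)) (at x)"
      using Suc.prems that by (simp add: frechet_derivative_works[symmetric])
  qed (use Suc.prems in auto)
  have eq: "frechet_derivative f (at x) v = frechet_derivative g (at x) v" if "x \<in> S" for x v
    using frechet_derivative_at[OF D[OF that]] by simp
  have "Ck_on k S (\<lambda>x. frechet_derivative g (at x) v)" for v
    by (rule Suc.IH[of "\<lambda>x. frechet_derivative f (at x) v"]) (use Suc.prems eq in auto)
  then show ?case
    using D by (auto simp: differentiable_def)
qed

lemma has_derivative_linear_subst:
  fixes L :: "'a::euclidean_space \<Rightarrow> 'b::euclidean_space" and f :: "'b \<Rightarrow> real"
  assumes "linear L" "f differentiable (at (L x))"
  shows "((\<lambda>x. f (L x)) has_derivative (\<lambda>v. frechet_derivative f (at (L x)) (L v))) (at x)"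
  using diff_chain_at[of L L x f "frechet_derivative f (at (L x))"] assms
  by (simp add: comp_def frechet_derivative_works[symmetric] linear_imp_has_derivative)

lemma frechet_derivative_linear_subst:
  fixes L :: "'a::euclidean_space \<Rightarrow> 'b::euclidean_space" and f :: "'b \<Rightarrow> real"
  assumes "linear L" "f differentiable (at (L x))"
  shows "frechet_derivative (\<lambda>x. f (L x)) (at x) v = frechet_derivative f (at (L x)) (L v)"
  using fun_cong[OF frechet_derivative_at[OF has_derivative_linear_subst[OF assms]], of v] by simp

text \<open>
  By the chain rule, the derivative of \<open>f \<circ> L\<close> in direction \<open>v\<close> is the composition of \<open>L\<close>
  with the derivative of \<open>f\<close> in the fixed direction \<open>L v\<close>, so the claim reduces to the same
  claim for one derivative less.
\<close>

lemma Ck_on_linear_subst: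
  fixes L :: "'a::euclidean_space \<Rightarrow> 'b::euclidean_space"
  assumes L: "linear L" and S: "open S" and f: "Ck_on k S f"
  shows "Ck_on k (L -` S) (\<lambda>x. f (L x))"
  using f
proof (induction k arbitrary: f)
  case 0
  then show ?case
    using linear_continuous_on[of L] L
    by (auto intro!: continuous_on_compose2[of S f] simp: linear_conv_bounded_linear)
next
  case (Suc k)
  have op: "open (L -` S)"
    using L S by (intro open_vimage) (simp_all add: linear_continuous_on linear_conv_bounded_linear)
  have "Ck_on k (L -` S) (\<lambda>x. frechet_derivative (\<lambda>x. f (L x)) (at x) v)" for v
  proof (rule Ck_on_cong[OF op])
    show "Ck_on k (L -` S) (\<lambda>x. frechet_derivative f (at (L x)) (L v))"
      using Suc.IH[of "\<lambda>y. frechet_derivative f (at y) (L v)"] Suc.prems by auto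
    fix x assume "x \<in> L -` S"
    then have "f differentiable (at (L x))"
      using Suc.prems by simp
    then show "frechet_derivative f (at (L x)) (L v) = frechet_derivative (\<lambda>x. f (L x)) (at x) v"
      by (rule frechet_derivative_linear_subst[OF L, symmetric])
  qed
  then show ?case
    using Suc.prems by (auto intro: differentiableI[OF has_derivative_linear_subst[OF L]])
qed

lemma smooth_on_linear_subst:
  "linear L \<Longrightarrow> open S \<Longrightarrow> smooth_on S f \<Longrightarrow> smooth_on (L -` S) (\<lambda>x. f (L x))"
  unfolding smooth_on_def by (blast intro: Ck_on_linear_subst)

lemma smooth_on_differentiable: "smooth_on S f \<Longrightarrow> x \<in> S \<Longrightarrow> f differentiable (at x)"
  unfolding smooth_on_def by (drule spec[of _ "Suc 0"]) simp

text \<open>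
  The witness is \<open>\<phi> \<circ> L'\<close> with the inverse dilation \<open>L'\<close>. In this way a test function for
  the transformed problem yields one for the original problem.
\<close>

lemma smooth_on_vimage_dilation:
  assumes L: "axis_dilation L" and S: "open S" and \<phi>: "smooth_on (L -` S) \<phi>"
  obtains \<psi> where "smooth_on S \<psi>" "\<phi> = (\<lambda>x. \<psi> (L x))"
proof -
  obtain L' where L': "axis_dilation L'" "\<And>x. L (L' x) = x" "\<And>x. L' (L x) = x"
    using axis_dilation_inverse[OF L] by metis
  have "open (L -` S)"
    using axis_dilation_linear[OF L] S
    by (intro open_vimage) (simp_all add: linear_continuous_on linear_conv_bounded_linear)
  then have "smooth_on (L' -` L -` S) (\<lambda>x. \<phi> (L' x))"
    using \<phi> L'(1) by (intro smooth_on_linear_subst axis_dilation_linear)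
  moreover have "L' -` L -` S = S"
    using L'(2) by auto
  ultimately show thesis
    by (intro that[of "\<lambda>x. \<phi> (L' x)"]) (simp_all add: L'(3))
qed

section \<open>The function spaces\<close>

lemma Lq_loc_dilation:
  fixes A :: "real^'n::finite \<Rightarrow> real^'n"
  assumes A: "axis_dilation A" and f: "Lq_loc q S f"
  shows "Lq_loc q (A -` S) (\<lambda>x. k * f (A x))"
  unfolding Lq_loc_def
proof (intro conjI allI impI)
  have "(\<lambda>x. f (A x)) \<in> borel_measurable (lebesgue_on (A -` S))"
    using f by (intro measurable_on_dilation A) (simp add: Lq_loc_def)
  then show "(\<lambda>x. k * f (A x)) \<in> borel_measurable (lebesgue_on (A -` S))"
    by simp
next
  fix K assume "compact K \<and> K \<subseteq> A -` S"
  then obtain K' where K': "compact K'" "K' \<subseteq> S" "K = A -` K'"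
    using compact_subset_vimage_dilation[OF A] by metis
  then have "set_integrable lebesgue K' (\<lambda>x. \<bar>f x\<bar> powr q)"
    using f by (simp add: Lq_loc_def)
  from set_integrable_dilation[OF A this]
  have "set_integrable lebesgue K (\<lambda>x. \<bar>k\<bar> powr q * \<bar>f (A x)\<bar> powr q)"
    by (intro set_integrable_mult_right) (simp add: K'(3))
  then show "set_integrable lebesgue K (\<lambda>x. \<bar>k * f (A x)\<bar> powr q)"
    by (simp add: abs_mult powr_mult)
qed

lemma Lq_loc_Lq_loc_dilation:
  fixes A :: "real^'n::finite \<Rightarrow> real^'n"
  assumes A: "axis_dilation A" and \<tau>: "\<tau> > 0" and f: "Lq_loc_Lq_loc q I S f"
  shows "Lq_loc_Lq_loc q ((*) \<tau> -` I) (A -` S) (\<lambda>(x, t). k * f (A x, \<tau> * t))"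
  unfolding Lq_loc_Lq_loc_def
proof (intro conjI allI impI)
  have "(\<lambda>z. f (map_prod A ((*) \<tau>) z)) \<in> borel_measurable (lebesgue_on (map_prod A ((*) \<tau>) -` (S \<times> I)))"
    using f by (intro measurable_on_dilation axis_dilation_map_prod axis_dilation_real A \<tau>)
      (simp add: Lq_loc_Lq_loc_def)
  moreover have "map_prod A ((*) \<tau>) -` (S \<times> I) = A -` S \<times> (*) \<tau> -` I"
    by auto
  ultimately show "(\<lambda>(x, t). k * f (A x, \<tau> * t)) \<in> borel_measurable (lebesgue_on (A -` S \<times> (*) \<tau> -` I))"
    by (simp add: map_prod_def case_prod_beta')
next
  have "AE t in lebesgue. t \<in> I \<longrightarrow> Lq_loc q S (\<lambda>x. f (x, t))"
    using f by (simp add: Lq_loc_Lq_loc_def)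
  from AE_dilation[OF axis_dilation_real[OF \<tau>] this]
  show "AE t\<in>(*) \<tau> -` I in lebesgue. Lq_loc q (A -` S) (\<lambda>x. case (x, t) of (x, t) \<Rightarrow> k * f (A x, \<tau> * t))"
    by (rule AE_mp) (auto intro!: AE_I2 Lq_loc_dilation[OF A])
next
  fix J K assume "compact J \<and> J \<subseteq> (*) \<tau> -` I \<and> compact K \<and> K \<subseteq> A -` S"
  then obtain J' K' where J': "compact J'" "J' \<subseteq> I" "J = (*) \<tau> -` J'"
    and K': "compact K'" "K' \<subseteq> S" "K = A -` K'"
    using compact_subset_vimage_dilation[OF A] compact_subset_vimage_dilation[OF axis_dilation_real[OF \<tau>]]
    by metis
  have "set_integrable lebesgue J' (\<lambda>t. LINT x:K'|lebesgue. \<bar>f (x, t)\<bar> powr q)"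
    using f J' K' by (simp add: Lq_loc_Lq_loc_def)
  from set_integrable_dilation[OF axis_dilation_real[OF \<tau>] this]
  have "set_integrable lebesgue J
      (\<lambda>t. \<bar>k\<bar> powr q / dilation_det A * (LINT x:K'|lebesgue. \<bar>f (x, \<tau> * t)\<bar> powr q))"
    by (intro set_integrable_mult_right) (simp add: J'(3))
  moreover have "(LINT x:K|lebesgue. \<bar>k * f (A x, \<tau> * t)\<bar> powr q) =
      \<bar>k\<bar> powr q / dilation_det A * (LINT x:K'|lebesgue. \<bar>f (x, \<tau> * t)\<bar> powr q)" for t
    using set_integral_dilation[OF A, of K' "\<lambda>x. \<bar>k\<bar> powr q * \<bar>f (x, \<tau> * t)\<bar> powr q"]
    by (simp add: abs_mult powr_mult K'(3))
  ultimately show "set_integrable lebesgue J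
      (\<lambda>t. LINT x:K|lebesgue. \<bar>case (x, t) of (x, t) \<Rightarrow> k * f (A x, \<tau> * t)\<bar> powr q)"
    by simp
qed

text \<open>
  The factor \<open>a\<close> is that of the chain rule; here it arises from the derivative of the test
  function \<open>\<psi> \<circ> A\<close> along the \<open>i\<close>-th axis.
\<close>

lemma weak_partial_dilation:
  fixes A :: "real^'n::finite \<Rightarrow> real^'n"
  assumes A: "axis_dilation A" and a: "A (axis i 1) = a *\<^sub>R axis i 1"
    and S: "open S" and fg: "weak_partial S i f g"
  shows "weak_partial (A -` S) i (\<lambda>x. k * f (A x)) (\<lambda>x. k * a * g (A x))"
  unfolding weak_partial_def
proof (intro conjI ballI)
  show "Lq_loc 1 (A -` S) (\<lambda>x. k * f (A x))" "Lq_loc 1 (A -` S) (\<lambda>x. k * a * g (A x))"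
    using fg by (auto simp: weak_partial_def intro: Lq_loc_dilation[OF A])
  fix \<phi> :: "real^'n \<Rightarrow> real"
  assume "\<phi> \<in> test_functions (A -` S)"
  then obtain K where smooth: "smooth_on (A -` S) \<phi>"
    and K: "compact K" "K \<subseteq> A -` S" "\<And>x. x \<in> A -` S - K \<Longrightarrow> \<phi> x = 0"
    by (auto simp: test_functions_def)
  obtain \<psi> where \<psi>: "smooth_on S \<psi>" "\<phi> = (\<lambda>x. \<psi> (A x))"
    using smooth_on_vimage_dilation[OF A S smooth] by blast
  obtain K' where K': "compact K'" "K' \<subseteq> S" "K = A -` K'"
    using compact_subset_vimage_dilation[OF A K(1,2)] by blast
  have "\<psi> y = 0" if "y \<in> S - K'" for y
  proof -
    obtain x where "y = A x"
      using axis_dilation_inverse[OF A] by metis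
    then show ?thesis
      using that K(3)[of x] by (simp add: K'(3) \<psi>(2))
  qed
  then have test: "\<psi> \<in> test_functions S"
    using \<psi>(1) K' by (auto simp: test_functions_def)
  have deriv: "frechet_derivative \<phi> (at x) (axis i 1) = a * frechet_derivative \<psi> (at (A x)) (axis i 1)"
    if "x \<in> A -` S" for x
  proof -
    have diff: "\<psi> differentiable (at (A x))"
      using smooth_on_differentiable[OF \<psi>(1)] that by simp
    show ?thesis
      using frechet_derivative_linear_subst[OF axis_dilation_linear[OF A] diff]
        linear_scale[OF linear_frechet_derivative[OF diff]]
      by (simp add: \<psi>(2) a)
  qed
  have "(LINT x:A -` S|lebesgue. k * f (A x) * frechet_derivative \<phi> (at x) (axis i 1)) =
      (LINT x:A -` S|lebesgue. (k * a) * (f (A x) * frechet_derivative \<psi> (at (A x)) (axis i 1)))"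
    by (rule set_integral_cong_all) (simp add: deriv)
  also have "\<dots> = k * a / dilation_det A * (LINT x:S|lebesgue. f x * frechet_derivative \<psi> (at x) (axis i 1))"
    using set_integral_dilation[OF A, of S "\<lambda>x. (k * a) * (f x * frechet_derivative \<psi> (at x) (axis i 1))"]
    by simp
  also have "\<dots> = - (k * a / dilation_det A * (LINT x:S|lebesgue. g x * \<psi> x))"
    using fg test by (simp add: weak_partial_def)
  also have "\<dots> = - (LINT x:A -` S|lebesgue. k * a * g (A x) * \<phi> x)"
    using set_integral_dilation[OF A, of S "\<lambda>x. (k * a) * (g x * \<psi> x)"]
    by (simp add: \<psi>(2) mult.assoc)
  finally show "(LINT x:A -` S|lebesgue. k * f (A x) * frechet_derivative \<phi> (at x) (axis i 1)) =
      - (LINT x:A -` S|lebesgue. k * a * g (A x) * \<phi> x)" .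
qed

lemma L1_loc_W11_loc_dilation:
  fixes A :: "real^'n::finite \<Rightarrow> real^'n"
  assumes A: "axis_dilation A" and a: "\<And>i. A (axis i 1) = a i *\<^sub>R axis i 1" and \<tau>: "\<tau> > 0"
    and S: "open S" and u: "L1_loc_W11_loc I S u Du"
  shows "L1_loc_W11_loc ((*) \<tau> -` I) (A -` S)
    (\<lambda>(x, t). k * u (A x, \<tau> * t)) (\<lambda>i (x, t). k * a i * Du i (A x, \<tau> * t))"
  unfolding L1_loc_W11_loc_def
proof (intro conjI allI)
  show "Lq_loc_Lq_loc 1 ((*) \<tau> -` I) (A -` S) (\<lambda>(x, t). k * u (A x, \<tau> * t))"
    "Lq_loc_Lq_loc 1 ((*) \<tau> -` I) (A -` S) (\<lambda>(x, t). k * a i * Du i (A x, \<tau> * t))" for i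
    using u by (auto simp: L1_loc_W11_loc_def intro: Lq_loc_Lq_loc_dilation[OF A \<tau>])
  have "AE t in lebesgue. t \<in> I \<longrightarrow> (\<forall>i. weak_partial S i (\<lambda>x. u (x, t)) (\<lambda>x. Du i (x, t)))"
    using u by (simp add: L1_loc_W11_loc_def)
  from AE_dilation[OF axis_dilation_real[OF \<tau>] this]
  show "AE t\<in>(*) \<tau> -` I in lebesgue. \<forall>i. weak_partial (A -` S) i
      (\<lambda>x. case (x, t) of (x, t) \<Rightarrow> k * u (A x, \<tau> * t))
      (\<lambda>x. case (x, t) of (x, t) \<Rightarrow> k * a i * Du i (A x, \<tau> * t))"
    by (rule AE_mp) (auto intro!: AE_I2 weak_partial_dilation[OF A a S])
qed

lemma C0_L2_loc_dilation:
  fixes A :: "real^'n::finite \<Rightarrow> real^'n"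
  assumes A: "axis_dilation A" and \<tau>: "\<tau> > 0" and u: "C0_L2_loc I S u"
  shows "C0_L2_loc ((*) \<tau> -` I) (A -` S) (\<lambda>(x, t). k * u (A x, \<tau> * t))"
  unfolding C0_L2_loc_def
proof (intro conjI ballI allI impI)
  fix t assume "t \<in> (*) \<tau> -` I"
  then show "Lq_loc 2 (A -` S) (\<lambda>x. case (x, t) of (x, t) \<Rightarrow> k * u (A x, \<tau> * t))"
    using u by (auto simp: C0_L2_loc_def intro: Lq_loc_dilation[OF A])
next
  fix K s assume "compact K \<and> K \<subseteq> A -` S" and s: "s \<in> (*) \<tau> -` I"
  then obtain K' where K': "compact K'" "K' \<subseteq> S" "K = A -` K'"
    using compact_subset_vimage_dilation[OF A] by metis
  define G where "G = (\<lambda>t. LINT x:K'|lebesgue. (u (x, t) - u (x, \<tau> * s))\<^sup>2)"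
  have "(G \<longlongrightarrow> 0) (at (\<tau> * s) within I)"
    using u s K' by (auto simp: C0_L2_loc_def G_def)
  moreover have "filterlim ((*) \<tau>) (at (\<tau> * s) within I) (at s within (*) \<tau> -` I)"
    unfolding filterlim_at
  proof
    show "\<forall>\<^sub>F t in at s within (*) \<tau> -` I. \<tau> * t \<in> I \<and> \<tau> * t \<noteq> \<tau> * s"
      using \<tau> by (auto simp: eventually_at_filter)
  qed (intro tendsto_intros)
  ultimately have "((\<lambda>t. G (\<tau> * t)) \<longlongrightarrow> 0) (at s within (*) \<tau> -` I)"
    by (rule filterlim_compose)
  then have "((\<lambda>t. k\<^sup>2 / dilation_det A * G (\<tau> * t)) \<longlongrightarrow> 0) (at s within (*) \<tau> -` I)"
    by (rule tendsto_mult_right_zero)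
  moreover have "(LINT x:K|lebesgue. (k * u (A x, \<tau> * t) - k * u (A x, \<tau> * s))\<^sup>2) =
      k\<^sup>2 / dilation_det A * G (\<tau> * t)" for t
    using set_integral_dilation[OF A, of K' "\<lambda>x. k\<^sup>2 * (u (x, \<tau> * t) - u (x, \<tau> * s))\<^sup>2"]
    by (simp add: K'(3) G_def power_mult_distrib flip: right_diff_distrib)
  ultimately show "((\<lambda>t. LINT x:K|lebesgue. ((case (x, t) of (x, t) \<Rightarrow> k * u (A x, \<tau> * t)) -
      (case (x, s) of (x, t) \<Rightarrow> k * u (A x, \<tau> * t)))\<^sup>2) \<longlongrightarrow> 0) (at s within (*) \<tau> -` I)"
    by simp
qed

section \<open>Scaling of the equation\<close>

text \<open>
  The left side is one summand of the diffusion term of \<open>v\<close>: \<open>k * a * d\<close> is the partial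
  derivative of \<open>v\<close>, and \<open>a * e\<close> that of the test function. Collecting powers gives
  \<open>k powr (p - 1) * a powr p\<close>, which the scaling relation turns into \<open>k * \<tau>\<close>, the factor
  that the time-derivative term also carries.
\<close>

lemma flux_scaling:
  fixes a d e k p \<tau> :: real
  assumes "a > 0" "k > 0" "a powr p = k powr (2 - p) * \<tau>"
  shows "\<bar>k * a * d\<bar> powr (p - 2) * (k * a * d) * (a * e) = k * \<tau> * (\<bar>d\<bar> powr (p - 2) * d * e)"
proof -
  have "a powr p = a powr (p - 2) * a\<^sup>2"
    using \<open>a > 0\<close> by (simp add: powr_diff)
  then have "k powr (p - 2) * (a powr (p - 2) * a\<^sup>2) = k powr (p - 2) * k powr (2 - p) * \<tau>"
    using assms(3) by simp
  also have "\<dots> = \<tau>"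
    using \<open>k > 0\<close> by (simp flip: powr_add)
  finally have \<tau>: "k powr (p - 2) * (a powr (p - 2) * a\<^sup>2) = \<tau>" .
  have "\<bar>k * a * d\<bar> powr (p - 2) = k powr (p - 2) * a powr (p - 2) * \<bar>d\<bar> powr (p - 2)"
    using assms by (simp add: abs_mult powr_mult)
  then have "\<bar>k * a * d\<bar> powr (p - 2) * (k * a * d) * (a * e) =
      k * (k powr (p - 2) * (a powr (p - 2) * a\<^sup>2)) * (\<bar>d\<bar> powr (p - 2) * d * e)"
    by (simp add: power2_eq_square)
  then show ?thesis
    unfolding \<tau> .
qed

lemma partial_dilation:
  fixes A :: "real^'n::finite \<Rightarrow> real^'n"
  assumes A: "axis_dilation A" and a: "A (axis i 1) = a *\<^sub>R axis i 1" and \<tau>: "\<tau> > 0"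
    and \<psi>: "\<psi> differentiable (at (A x, \<tau> * t))"
  shows "partial_x i (\<lambda>z. \<psi> (map_prod A ((*) \<tau>) z)) (x, t) = a * partial_x i \<psi> (A x, \<tau> * t)"
    and "partial_t (\<lambda>z. \<psi> (map_prod A ((*) \<tau>) z)) (x, t) = \<tau> * partial_t \<psi> (A x, \<tau> * t)"
proof -
  have lin: "linear (map_prod A ((*) \<tau>))"
    by (intro axis_dilation_linear axis_dilation_map_prod axis_dilation_real A \<tau>)
  have "frechet_derivative (\<lambda>z. \<psi> (map_prod A ((*) \<tau>) z)) (at (x, t)) v =
      frechet_derivative \<psi> (at (A x, \<tau> * t)) (map_prod A ((*) \<tau>) v)" for v
    using frechet_derivative_linear_subst[OF lin, of \<psi> "(x, t)"] \<psi> by simp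
  moreover have "map_prod A ((*) \<tau>) (axis i 1, 0) = a *\<^sub>R (axis i 1, 0)"
    "map_prod A ((*) \<tau>) (0, 1) = \<tau> *\<^sub>R (0, 1)"
    using linear_0[OF axis_dilation_linear[OF A]] by (simp_all add: a)
  moreover have "frechet_derivative \<psi> (at (A x, \<tau> * t)) (r *\<^sub>R v) =
      r * frechet_derivative \<psi> (at (A x, \<tau> * t)) v" for r v
    using linear_scale[OF linear_frechet_derivative[OF \<psi>]] by simp
  ultimately show "partial_x i (\<lambda>z. \<psi> (map_prod A ((*) \<tau>) z)) (x, t) = a * partial_x i \<psi> (A x, \<tau> * t)"
    "partial_t (\<lambda>z. \<psi> (map_prod A ((*) \<tau>) z)) (x, t) = \<tau> * partial_t \<psi> (A x, \<tau> * t)"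
    unfolding partial_x_def partial_t_def by metis+
qed

text \<open>
  The scaling relation makes all terms of the space-time integrand carry the factor
  \<open>k * \<tau>\<close>. The change of variables divides the space-time integral by \<open>\<tau> * dilation_det A\<close> and
  the integrals over time slices, which carry only \<open>k\<close>, by \<open>dilation_det A\<close>. Thus the
  factor \<open>k / dilation_det A\<close> is common to the whole identity.
\<close>

lemma local_weak_solution_dilation:
  fixes A :: "real^'n::finite \<Rightarrow> real^'n"
  assumes A: "axis_dilation A" and a: "\<And>i. A (axis i 1) = a i *\<^sub>R axis i 1" "\<And>i. a i > 0"
    and \<tau>: "\<tau> > 0" and k: "k > 0"
    and scale: "\<And>i. a i powr p i = k powr (2 - p i) * \<tau>"
    and S: "open S" and I: "open I" "is_interval I"
    and u: "local_weak_solution p S I u"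
  shows "local_weak_solution p (A -` S) ((*) \<tau> -` I) (\<lambda>(x, t). k * u (A x, \<tau> * t))"
proof -
  let ?T = "map_prod A ((*) \<tau>)"
  obtain Du where Du: "L1_loc_W11_loc I S u Du" "\<And>i. Lq_loc_Lq_loc (p i) I S (Du i)"
    and weak: "\<And>t1 t2 K \<phi>. t1 \<in> I \<Longrightarrow> t2 \<in> I \<Longrightarrow> t1 < t2 \<Longrightarrow> compact K \<Longrightarrow> K \<subseteq> S \<Longrightarrow>
      smooth_on (S \<times> I) \<phi> \<Longrightarrow> (\<forall>t\<in>I. \<forall>x\<in>S - K. \<phi> (x, t) = 0) \<Longrightarrow>
      (LINT x:K|lebesgue. u (x, t2) * \<phi> (x, t2)) - (LINT x:K|lebesgue. u (x, t1) * \<phi> (x, t1)) +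
      (LINT t:{t1..t2}|lebesgue. LINT x:K|lebesgue. - (u (x, t) * partial_t \<phi> (x, t)) +
        (\<Sum>i\<in>UNIV. \<bar>Du i (x, t)\<bar> powr (p i - 2) * Du i (x, t) * partial_x i \<phi> (x, t))) = 0"
    using u unfolding local_weak_solution_def by blast
  define Dv where "Dv i = (\<lambda>(x, t). k * a i * Du i (A x, \<tau> * t))" for i
  have T: "axis_dilation ?T"
    by (intro axis_dilation_map_prod axis_dilation_real A \<tau>)
  have time: "axis_dilation ((*) \<tau>)"
    by (rule axis_dilation_real[OF \<tau>])
  have det_time: "dilation_det ((*) \<tau>) = \<tau>"
    by (simp add: dilation_det_def)
  have dom: "A -` S \<times> (*) \<tau> -` I = ?T -` (S \<times> I)"
    by auto
  have weak': "(LINT x:K|lebesgue. k * u (A x, \<tau> * t2) * \<phi> (x, t2)) -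
      (LINT x:K|lebesgue. k * u (A x, \<tau> * t1) * \<phi> (x, t1)) +
      (LINT t:{t1..t2}|lebesgue. LINT x:K|lebesgue. - (k * u (A x, \<tau> * t) * partial_t \<phi> (x, t)) +
        (\<Sum>i\<in>UNIV. \<bar>Dv i (x, t)\<bar> powr (p i - 2) * Dv i (x, t) * partial_x i \<phi> (x, t))) = 0"
    if t: "\<tau> * t1 \<in> I" "\<tau> * t2 \<in> I" "t1 < t2" and K: "compact K" "K \<subseteq> A -` S"
      and \<phi>: "smooth_on (A -` S \<times> (*) \<tau> -` I) \<phi>"
      and supp: "\<And>x t. \<tau> * t \<in> I \<Longrightarrow> x \<in> A -` S - K \<Longrightarrow> \<phi> (x, t) = 0"
    for t1 t2 K \<phi>
  proof -
    obtain \<psi> where \<psi>: "smooth_on (S \<times> I) \<psi>" "\<phi> = (\<lambda>z. \<psi> (?T z))"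
      using smooth_on_vimage_dilation[OF T open_Times[OF S I(1)]] \<phi> dom by metis
    obtain K' where K': "compact K'" "K' \<subseteq> S" "K = A -` K'"
      using compact_subset_vimage_dilation[OF A K] by blast
    have supp': "\<psi> (y, s) = 0" if "s \<in> I" "y \<in> S - K'" for y s
    proof -
      obtain x where "y = A x"
        using axis_dilation_inverse[OF A] by metis
      moreover have "s = \<tau> * (s / \<tau>)"
        using \<tau> by simp
      ultimately show ?thesis
        using supp[of "s / \<tau>" x] that by (simp add: \<psi>(2) K'(3))
    qed
    define h where "h x t = - (u (x, t) * partial_t \<psi> (x, t)) +
        (\<Sum>i\<in>UNIV. \<bar>Du i (x, t)\<bar> powr (p i - 2) * Du i (x, t) * partial_x i \<psi> (x, t))" for x t
    \<comment> \<open>The chain rule for \<open>\<phi>\<close> applies at points that are mapped into \<open>S \<times> I\<close>; since \<open>I\<close> is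
      an interval, this includes all times between \<open>t1\<close> and \<open>t2\<close>.\<close>
    have integrand: "- (k * u (A x, \<tau> * t) * partial_t \<phi> (x, t)) +
        (\<Sum>i\<in>UNIV. \<bar>Dv i (x, t)\<bar> powr (p i - 2) * Dv i (x, t) * partial_x i \<phi> (x, t)) =
        k * \<tau> * h (A x) (\<tau> * t)" if "x \<in> K" "t \<in> {t1..t2}" for x t
    proof -
      have "\<tau> * t \<in> I"
        using t that(2) \<tau> I(2) by (auto intro: mem_is_interval_1_I[of I "\<tau> * t1" "\<tau> * t2"])
      then have diff: "\<psi> differentiable (at (A x, \<tau> * t))"
        using smooth_on_differentiable[OF \<psi>(1)] that(1) K' by auto
      have "\<bar>Dv i (x, t)\<bar> powr (p i - 2) * Dv i (x, t) * partial_x i \<phi> (x, t) =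
          k * \<tau> * (\<bar>Du i (A x, \<tau> * t)\<bar> powr (p i - 2) * Du i (A x, \<tau> * t) * partial_x i \<psi> (A x, \<tau> * t))"
        for i
        using flux_scaling[OF a(2) k scale] partial_dilation(1)[OF A a(1) \<tau> diff]
        by (simp add: Dv_def \<psi>(2))
      then show ?thesis
        using partial_dilation(2)[OF A a(1) \<tau> diff]
        by (simp add: h_def \<psi>(2) algebra_simps sum_distrib_left)
    qed
    have slice: "(LINT x:K|lebesgue. k * u (A x, \<tau> * t) * \<phi> (x, t)) =
        k / dilation_det A * (LINT x:K'|lebesgue. u (x, \<tau> * t) * \<psi> (x, \<tau> * t))" for t
      using set_integral_dilation[OF A, of K' "\<lambda>x. k * (u (x, \<tau> * t) * \<psi> (x, \<tau> * t))"]
      by (simp add: K'(3) \<psi>(2) mult.assoc)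
    have preimage: "{t1..t2} = (*) \<tau> -` {\<tau> * t1..\<tau> * t2}"
      using \<tau> by auto
    have "(LINT t:{t1..t2}|lebesgue. LINT x:K|lebesgue. - (k * u (A x, \<tau> * t) * partial_t \<phi> (x, t)) +
        (\<Sum>i\<in>UNIV. \<bar>Dv i (x, t)\<bar> powr (p i - 2) * Dv i (x, t) * partial_x i \<phi> (x, t))) =
        (LINT t:{t1..t2}|lebesgue. LINT x:K|lebesgue. k * \<tau> * h (A x) (\<tau> * t))"
      by (intro set_integral_cong_all integrand)
    also have "\<dots> = (LINT t:{t1..t2}|lebesgue. k * \<tau> / dilation_det A * (LINT x:K'|lebesgue. h x (\<tau> * t)))"
      using set_integral_dilation[OF A, of K' "\<lambda>x. k * \<tau> * h x (\<tau> * t)" for t] by (simp add: K'(3))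
    also have "\<dots> = k * \<tau> / dilation_det A * ((LINT t:{\<tau> * t1..\<tau> * t2}|lebesgue. LINT x:K'|lebesgue. h x t) / \<tau>)"
      unfolding preimage using set_integral_dilation[OF time, of "{\<tau> * t1..\<tau> * t2}" "\<lambda>t. LINT x:K'|lebesgue. h x t"]
      by (simp add: det_time)
    also have "\<dots> = k / dilation_det A * (LINT t:{\<tau> * t1..\<tau> * t2}|lebesgue. LINT x:K'|lebesgue. h x t)"
      using \<tau> by simp
    finally have bulk: "(LINT t:{t1..t2}|lebesgue. LINT x:K|lebesgue. - (k * u (A x, \<tau> * t) * partial_t \<phi> (x, t)) +
        (\<Sum>i\<in>UNIV. \<bar>Dv i (x, t)\<bar> powr (p i - 2) * Dv i (x, t) * partial_x i \<phi> (x, t))) =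
        k / dilation_det A * (LINT t:{\<tau> * t1..\<tau> * t2}|lebesgue. LINT x:K'|lebesgue. h x t)" .
    have "(LINT x:K'|lebesgue. u (x, \<tau> * t2) * \<psi> (x, \<tau> * t2)) -
        (LINT x:K'|lebesgue. u (x, \<tau> * t1) * \<psi> (x, \<tau> * t1)) +
        (LINT t:{\<tau> * t1..\<tau> * t2}|lebesgue. LINT x:K'|lebesgue. h x t) = 0"
      unfolding h_def using t \<tau> by (intro weak K' \<psi>) (auto intro: supp')
    then have "k / dilation_det A * ((LINT x:K'|lebesgue. u (x, \<tau> * t2) * \<psi> (x, \<tau> * t2)) -
        (LINT x:K'|lebesgue. u (x, \<tau> * t1) * \<psi> (x, \<tau> * t1)) +
        (LINT t:{\<tau> * t1..\<tau> * t2}|lebesgue. LINT x:K'|lebesgue. h x t)) = 0"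
      by simp
    then show ?thesis
      unfolding bulk slice by (simp only: ring_distribs)
  qed
  have "L1_loc_W11_loc ((*) \<tau> -` I) (A -` S) (\<lambda>(x, t). k * u (A x, \<tau> * t)) Dv"
    using L1_loc_W11_loc_dilation[OF A a(1) \<tau> S Du(1)] unfolding Dv_def .
  moreover have "Lq_loc_Lq_loc (p i) ((*) \<tau> -` I) (A -` S) (Dv i)" for i
    unfolding Dv_def by (rule Lq_loc_Lq_loc_dilation[OF A \<tau> Du(2)])
  moreover have "C0_L2_loc ((*) \<tau> -` I) (A -` S) (\<lambda>(x, t). k * u (A x, \<tau> * t))"
    using u by (intro C0_L2_loc_dilation A \<tau>) (simp add: local_weak_solution_def)
  ultimately show ?thesis
    unfolding local_weak_solution_def using weak'
    by (intro conjI exI[of _ Dv] allI impI) auto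
qed

theorem proposition2p1:
  fixes p :: "'n::{finite,linorder} \<Rightarrow> real"
    and \<Omega> :: "(real^'n::{finite,linorder}) set"
    and T M \<rho> :: real
    and u :: "(real^'n::{finite,linorder}) \<times> real \<Rightarrow> real"
  assumes "CARD('n) > 1"
    and "mono p"
    and "\<And>i. 2 < p i"
    and "pbar p < real CARD('n)"
    and "\<And>i. p i < pbar_star p"
    and "open \<Omega>" and "bounded \<Omega>"
    and "T > 0"
    and "local_weak_solution_in p (\<Omega> \<times> {-T<..<T}) u"
    and "M > 0" and "\<rho> > 0"
    and "full_cylinder p \<rho> M \<subseteq> \<Omega> \<times> {-T<..<T}"
  shows "local_weak_solution_in p (T_tilde p \<rho> M -` (\<Omega> \<times> {-T<..<T})) (transform p \<rho> M u)"
proof -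
  obtain S I where SI: "open S" "open I" "is_interval I" "\<Omega> \<times> {-T<..<T} = S \<times> I"
    and sol: "local_weak_solution p S I u"
    using assms(9) unfolding local_weak_solution_in_def by blast
  define a where "a i = M powr ((p i - 2) / p i) * \<rho> powr (pbar p / p i)" for i
  define A where "A = (\<lambda>x. \<chi> i. a i * x $ i)"
  define \<tau> where "\<tau> = \<rho> powr pbar p"
  have a: "a i > 0" for i
    using assms(10,11) by (simp add: a_def)
  have \<tau>: "\<tau> > 0"
    using assms(11) by (simp add: \<tau>_def)
  have A: "axis_dilation A"
    unfolding A_def by (rule axis_dilation_vec[OF a])
  have Aa: "A (axis i 1) = a i *\<^sub>R axis i 1" for i
    by (simp add: A_def vec_eq_iff axis_def)
  have scale: "a i powr p i = inverse M powr (2 - p i) * \<tau>" for i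
  proof -
    have "p i \<noteq> 0"
      using assms(3)[of i] by simp
    then have "a i powr p i = M powr (p i - 2) * \<tau>"
      using assms(10,11) by (simp add: a_def \<tau>_def powr_mult powr_powr)
    also have "M powr (p i - 2) = M powr - (2 - p i)"
      by simp
    also have "\<dots> = inverse M powr (2 - p i)"
      unfolding powr_minus using assms(10) by (simp only: inverse_powr less_imp_le)
    finally show ?thesis .
  qed
  have Tt: "T_tilde p \<rho> M = (\<lambda>(x, t). (A x, \<tau> * t))"
    by (simp add: T_tilde_def A_def a_def \<tau>_def)
  have tr: "transform p \<rho> M u = (\<lambda>(x, t). inverse M * u (A x, \<tau> * t))"
    by (auto simp: transform_def Tt)
  have "local_weak_solution p (A -` S) ((*) \<tau> -` I) (transform p \<rho> M u)"
    unfolding tr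
    by (rule local_weak_solution_dilation[OF A Aa a \<tau> _ scale SI(1-3) sol]) (use assms(10) in simp)
  moreover have "T_tilde p \<rho> M -` (\<Omega> \<times> {-T<..<T}) = A -` S \<times> (*) \<tau> -` I"
    unfolding SI(4) Tt by auto
  moreover have "open (A -` S)"
    using SI(1) axis_dilation_linear[OF A]
    by (intro open_vimage) (simp_all add: linear_continuous_on linear_conv_bounded_linear)
  moreover have "open ((*) \<tau> -` I)"
    using SI(2) by (intro open_vimage continuous_intros)
  moreover have "is_interval ((*) \<tau> -` I)"
    unfolding is_interval_1
  proof (intro ballI allI impI)
    fix r t s assume "r \<in> (*) \<tau> -` I" "t \<in> (*) \<tau> -` I" "r \<le> s \<and> s \<le> t"
    then show "s \<in> (*) \<tau> -` I"
      using \<tau> mem_is_interval_1_I[OF SI(3), of "\<tau> * r" "\<tau> * t" "\<tau> * s"] by simp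
  qed
  ultimately show ?thesis
    unfolding local_weak_solution_in_def by blast
qed

end
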